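(* Let $\lambda\ge 0$, let $K$ be a coagulation kernel for which there are $k_2>k_1>0$ such that $$k_1\left(x^\lambda+y^\lambda\right)\le K(x,y)\le k_2\left(x^\lambda+y^\lambda\right),\qquad (x,y)\in(0,\infty)^2,$$ let $S\in X_0^+$, and let $\varphi$ be a stationary solution to the coagulation equation with source $S$. If $w\in C((0,\infty))$ is a non-negative and non-increasing function and $S\in L^1((0,\infty),w(x)\,\mathrm{d}x)$, then $\varphi\in L^1((0,\infty),w(x)\,\mathrm{d}x)$. In particular, if $S\in X_m$ for some $m\in(-\infty,0)$, then $\varphi\in X_m$.
   Context: For $m\in\mathbb{R}$, $X_m:=L^1((0,\infty),x^m\,\mathrm{d}x)$, $X_{0,m}:=X_0\cap X_m$, and $X_m^+$, $X_{0,m}^+$ denote their positive cones (functions non-negative almost everywhere). A coagulation kernel is a measurable, non-negative and symmetric function $K$ on $(0,\infty)^2$, i.e. $K(x,y)=K(y,x)\ge 0$. The coagulation equation with source is $\partial_t f=\mathcal{C}f+S$ on $(0,\infty)^2$, where $\mathcal{C}f(x)=\frac12\int_0^x K(y,x-y)f(y)f(x-y)\,\mathrm{d}y-\int_0^\infty K(x,y)f(x)f(y)\,\mathrm{d}y$. A stationary solution to it (with source $S\in X_0^+$ and kernel $K$ satisfying, for some $\lambda\ge 0$ and $k_2>k_1>0$, the two-sided bound $k_1\left(x^\lambda+y^\lambda\right)\le K(x,y)\le k_2\left(x^\lambda+y^\lambda\right)$ for all $(x,y)\in(0,\infty)^2$) is a function $\varphi\in X_{0,\lambda}^+$ such that $$\frac12\int_0^\infty\int_0^\infty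 \chi_\vartheta(x,y)K(x,y)\varphi(x)\varphi(y)\,\mathrm{d}y\,\mathrm{d}x+\int_0^\infty S(x)\vartheta(x)\,\mathrm{d}x=0$$ for all $\vartheta\in L^\infty(0,\infty)$, where $\chi_\vartheta(x,y):=\vartheta(x+y)-\vartheta(x)-\vartheta(y)$ for $(x,y)\in(0,\infty)^2$. *)

theory Defs
  imports "HOL-Analysis.Analysis"
begin

text \<open>
  Functions on \<open>(0,\<infinity>)\<close> and \<open>(0,\<infinity>)\<^sup>2\<close> are represented by total functions on the reals of which
  only the values at positive arguments matter; elements of Lebesgue spaces are
  represented by Lebesgue measurable functions rather than by their classes.
\<close>

abbreviation lebesgue_pos :: "real measure" where
  "lebesgue_pos \<equiv> lebesgue_on {0<..}"

text \<open>\<open>L\<^sup>1((0,\<infinity>), w(x)dx)\<close>; \<open>w\<close> is meant to be measurable and non-negative on \<open>(0,\<infinity>)\<close>.\<close>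

definition weighted_L1 :: "(real \<Rightarrow> real) \<Rightarrow> (real \<Rightarrow> real) set" where
  "weighted_L1 w = {f. integrable (density lebesgue_pos (\<lambda>x. ennreal (w x))) f}"

definition X_space :: "real \<Rightarrow> (real \<Rightarrow> real) set" where
  "X_space m = weighted_L1 (\<lambda>x. x powr m)"

definition pos_cone :: "(real \<Rightarrow> real) set \<Rightarrow> (real \<Rightarrow> real) set" where
  "pos_cone E = {f \<in> E. AE x in lebesgue_pos. 0 \<le> f x}"

definition Linfty_pos :: "(real \<Rightarrow> real) set" where
  "Linfty_pos =
    {f \<in> borel_measurable lebesgue_pos. \<exists>C. AE x in lebesgue_pos. \<bar>f x\<bar> \<le> C}"

definition coagulation_kernel :: "(real \<Rightarrow> real \<Rightarrow> real) \<Rightarrow> bool" where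
  "coagulation_kernel K \<longleftrightarrow>
    (\<lambda>(x, y). K x y) \<in> borel_measurable (lebesgue_on ({0<..} \<times> {0<..})) \<and>
    (\<forall>x>0. \<forall>y>0. K x y = K y x \<and> 0 \<le> K x y)"

definition chi :: "(real \<Rightarrow> real) \<Rightarrow> real \<Rightarrow> real \<Rightarrow> real" where
  "chi \<theta> x y = \<theta> (x + y) - \<theta> x - \<theta> y"

text \<open>
  \<open>l\<close> is the growth exponent of the kernel. If \<open>K x y \<le> k * (x powr l + y powr l)\<close> for
  positive \<open>x\<close>, \<open>y\<close> and \<open>S \<in> X_space 0\<close>, then both integrals converge absolutely for every
  admissible \<open>\<theta>\<close>, so the convention of Bochner integration for non-integrable functions plays
  no role.
\<close>

definition stationary_solution ::
  "real \<Rightarrow> (real \<Rightarrow> real \<Rightarrow> real) \<Rightarrow> (real \<Rightarrow> real) \<Rightarrow> (real \<Rightarrow> real) \<Rightarrow> bool" where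
  "stationary_solution l K S \<phi> \<longleftrightarrow>
    \<phi> \<in> pos_cone (X_space 0 \<inter> X_space l) \<and>
    (\<forall>\<theta> \<in> Linfty_pos.
      1 / 2 * (LINT x|lebesgue_pos. LINT y|lebesgue_pos. chi \<theta> x y * K x y * \<phi> x * \<phi> y)
        + (LINT x|lebesgue_pos. S x * \<theta> x) = 0)"

end

theory Submission
  imports Defs
begin

text \<open>
  Test the equation with the truncations \<open>\<theta> = min w n\<close>. Since \<open>\<theta>\<close> is non-increasing,
  \<open>- chi \<theta> x y \<ge> \<theta> x\<close>, so the lower bound of the kernel turns the equation into
  \<open>k1 * (\<integral>y\<^sup>l \<phi> y dy) * (\<integral>\<theta> \<phi>) \<le> 2 * (\<integral>S \<theta>) \<le> 2 * (\<integral>S w)\<close>.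
  Unless \<open>\<phi> = 0\<close>, this bounds \<open>\<integral>\<theta> \<phi>\<close> uniformly in \<open>n\<close>, and monotone convergence concludes.
\<close>

section \<open>Lebesgue measurability and Borel representatives\<close>

lemma AE_lebesgue_on_iff:
  fixes A :: "'a::euclidean_space set"
  assumes "A \<in> sets lebesgue"
  shows "(AE x in lebesgue_on A. P x) \<longleftrightarrow> (AE x in lebesgue. x \<in> A \<longrightarrow> P x)"
  using assms by (simp add: AE_restrict_space_iff)

lemma AE_lebesgue_posI: "(\<And>x. 0 < x \<Longrightarrow> P x) \<Longrightarrow> AE x in lebesgue_pos. P x"
  by (rule AE_I2) simp

text \<open>Extended by zero, \<open>f\<close> is measurable for the completion of
  \<open>lborel\<close>, and such functions agree almost everywhere with Borel functions.\<close>

lemma lebesgue_on_borel_representative: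
  fixes f :: "'a::euclidean_space \<Rightarrow> real"
  assumes A: "A \<in> sets lebesgue" and f: "f \<in> borel_measurable (lebesgue_on A)"
  obtains g where "g \<in> borel_measurable borel" "AE x in lborel. x \<in> A \<longrightarrow> f x = g x"
proof -
  have "(\<lambda>x. if x \<in> A then f x else 0) \<in> borel_measurable lebesgue"
    using A f by (simp add: borel_measurable_if)
  then obtain g where g: "g \<in> borel_measurable lborel"
      "AE x in lborel. (if x \<in> A then f x else 0) = g x"
    using completion_ex_borel_measurable_real by blast
  show thesis
  proof (rule that)
    show "g \<in> borel_measurable borel" using g(1) by simp
    show "AE x in lborel. x \<in> A \<longrightarrow> f x = g x" using g(2) by eventually_elim auto
  qed
qed

text \<open>Lebesgue measure is complete, so a change on a null set keeps measurability. This brings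
  results about Borel representatives back to the original functions.\<close>

lemma borel_measurable_AE_lebesgue_on:
  fixes f g :: "'a::euclidean_space \<Rightarrow> real"
  assumes A: "A \<in> sets lebesgue" and f: "f \<in> borel_measurable (lebesgue_on A)"
    and "AE x in lebesgue_on A. f x = g x"
  shows "g \<in> borel_measurable (lebesgue_on A)"
proof -
  have "AE x in lebesgue. (if x \<in> A then f x else 0) = (if x \<in> A then g x else 0)"
    using assms(3) unfolding AE_lebesgue_on_iff[OF A] by eventually_elim auto
  then have "(\<lambda>x. if x \<in> A then g x else 0) \<in> borel_measurable lebesgue"
    by (rule borel_measurable_AE[OF borel_measurable_if_I[OF f A]])
  then show ?thesis by (rule borel_measurable_if_D)
qed

text \<open>
  A Lebesgue measurable function on the quadrant need not be product measurable, so Fubini's theorem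
  only applies after passing to Borel representatives.
\<close>

lemma kernel_integral_measurable:
  fixes f :: "real \<Rightarrow> real \<Rightarrow> real" and u :: "real \<Rightarrow> real"
  assumes f: "(\<lambda>(x, y). f x y) \<in> borel_measurable (lebesgue_on ({0<..} \<times> {0<..}))"
    and u: "u \<in> borel_measurable lebesgue_pos"
  shows "AE x in lebesgue_pos. (\<lambda>y. f x y * u y) \<in> borel_measurable lebesgue_pos"
    and "(\<lambda>x. LINT y|lebesgue_pos. f x y * u y) \<in> borel_measurable lebesgue_pos"
proof -
  have "{0::real<..} \<times> {0::real<..} \<in> sets lebesgue"
    by (intro sets_completionI_sets) (simp add: open_Times borel_open)
  then obtain g where g: "g \<in> borel_measurable borel"
      "AE z in lborel. z \<in> {0::real<..} \<times> {0::real<..} \<longrightarrow> (case z of (x, y) \<Rightarrow> f x y) = g z"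
    using f by (rule lebesgue_on_borel_representative)
  obtain v where v: "v \<in> borel_measurable borel" "AE y in lborel. y \<in> {0<..} \<longrightarrow> u y = v y"
    using lebesgue_on_borel_representative[OF _ u] by auto
  have g_prod: "g \<in> borel_measurable (lborel \<Otimes>\<^sub>M lborel)"
    using g(1) by (simp add: lborel_prod)
  have v': "AE y in lebesgue. y \<in> {0<..} \<longrightarrow> u y = v y"
    using v(2) by (rule AE_completion)
  \<comment> \<open>A null set of the plane has null slices for almost every \<open>x\<close>; the
    exceptional \<open>x\<close> are why slices are controlled only almost everywhere from here
    on.\<close>
  have "AE x in lborel. AE y in lborel. (x, y) \<in> {0<..} \<times> {0<..} \<longrightarrow> f x y = g (x, y)"
    using lborel_pair.AE_pair[unfolded lborel_prod, OF g(2)] by (simp only: prod.case)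
  then have "AE x in lborel. x \<in> {0<..} \<longrightarrow> (AE y in lebesgue_pos. f x y = g (x, y))"
    by eventually_elim (auto simp: AE_lebesgue_on_iff dest: AE_completion)
  then have "AE x in lebesgue_pos. AE y in lebesgue_pos. f x y = g (x, y)"
    by (auto simp: AE_lebesgue_on_iff dest: AE_completion)
  then have ae: "AE x in lebesgue_pos. AE y in lebesgue_pos. g (x, y) * v y = f x y * u y"
  proof eventually_elim
    case (elim x)
    moreover have "AE y in lebesgue_pos. u y = v y"
      using v' by (simp add: AE_lebesgue_on_iff)
    ultimately show ?case by eventually_elim simp
  qed
  have borel_slice: "(\<lambda>y. g (x, y) * v y) \<in> borel_measurable borel" for x
    using g_prod v(1) by measurable
  then have slice: "(\<lambda>y. g (x, y) * v y) \<in> borel_measurable lebesgue_pos" for x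
    by (intro measurable_restrict_space1 measurable_completion) simp
  show "AE x in lebesgue_pos. (\<lambda>y. f x y * u y) \<in> borel_measurable lebesgue_pos"
    using ae
  proof eventually_elim
    case (elim x)
    show ?case
      by (rule borel_measurable_AE_lebesgue_on[OF _ slice elim]) simp
  qed
  \<comment> \<open>With Borel data extended by zero, the inner integral is over the sigma-finite
    measure \<open>lborel\<close> and the integrand is jointly measurable, so \<open>J\<close> is
    Borel measurable in the parameter \<open>x\<close>.\<close>
  define J where "J x = (LINT y|lborel. (if y \<in> {0<..} then g (x, y) * v y else 0))" for x
  have "(\<lambda>(x, y). if y \<in> {0<..} then g (x, y) * v y else 0) \<in> borel_measurable (borel \<Otimes>\<^sub>M lborel)"
    using g_prod v(1) by measurable
  then have "J \<in> borel_measurable borel"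
    unfolding J_def by (rule lborel.borel_measurable_lebesgue_integral)
  then have J: "J \<in> borel_measurable lebesgue_pos"
    by (intro measurable_restrict_space1 measurable_completion) simp
  have J_eq: "J x = (LINT y|lebesgue_pos. g (x, y) * v y)" for x
  proof -
    have "(\<lambda>y. if y \<in> {0<..} then g (x, y) * v y else 0) \<in> borel_measurable lborel"
      using borel_slice[of x] by measurable
    then have "J x = (LINT y|lebesgue. (if y \<in> {0<..} then g (x, y) * v y else 0))"
      unfolding J_def by (rule integral_completion[symmetric])
    also have "\<dots> = (LINT y|lebesgue_pos. g (x, y) * v y)"
      by (rule Lebesgue_Measure.integral_restrict_UNIV) simp
    finally show ?thesis .
  qed
  have "AE x in lebesgue_pos. J x = (LINT y|lebesgue_pos. f x y * u y)"
    using ae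
  proof eventually_elim
    case (elim x)
    have "(\<lambda>y. f x y * u y) \<in> borel_measurable lebesgue_pos"
      by (rule borel_measurable_AE_lebesgue_on[OF _ slice elim]) simp
    then show ?case
      unfolding J_eq by (rule integral_cong_AE[OF slice _ elim])
  qed
  then show "(\<lambda>x. LINT y|lebesgue_pos. f x y * u y) \<in> borel_measurable lebesgue_pos"
    by (rule borel_measurable_AE_lebesgue_on[OF _ J, rotated]) simp
qed

section \<open>Weighted spaces as integrability conditions\<close>

text \<open>The density moves into the integrand. Measurability of \<open>f\<close> is a separate
  condition, since \<open>w x * f x\<close> carries no information about \<open>f\<close> where
  \<open>w\<close> vanishes.\<close>

lemma weighted_L1_iff:
  assumes "continuous_on {0<..} w" and "\<forall>x>0. 0 \<le> w x"
  shows "f \<in> weighted_L1 w \<longleftrightarrow>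
    f \<in> borel_measurable lebesgue_pos \<and> integrable lebesgue_pos (\<lambda>x. w x * f x)"
proof -
  have w: "w \<in> borel_measurable lebesgue_pos"
    using assms(1) by (intro continuous_imp_measurable_on_sets_lebesgue) auto
  have nonneg: "AE x in lebesgue_pos. 0 \<le> w x"
    using assms(2) by (intro AE_lebesgue_posI) auto
  show ?thesis
  proof (cases "f \<in> borel_measurable lebesgue_pos")
    case True
    then show ?thesis
      using integrable_real_density[OF w nonneg] by (simp add: weighted_L1_def)
  next
    case False
    then show ?thesis
      by (auto simp: weighted_L1_def dest!: borel_measurable_integrable)
  qed
qed

lemma X_space_iff:
  "f \<in> X_space m \<longleftrightarrow>
    f \<in> borel_measurable lebesgue_pos \<and> integrable lebesgue_pos (\<lambda>x. x powr m * f x)"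
  unfolding X_space_def
  by (rule weighted_L1_iff) (auto intro!: continuous_intros)

lemma X_space_0_iff: "f \<in> X_space 0 \<longleftrightarrow> integrable lebesgue_pos f"
proof -
  have "integrable lebesgue_pos (\<lambda>x. x powr 0 * f x) \<longleftrightarrow> integrable lebesgue_pos f"
    by (rule Bochner_Integration.integrable_cong) auto
  then show ?thesis
    by (auto simp: X_space_iff)
qed

section \<open>The estimate obtained from a bounded non-increasing test function\<close>

text \<open>Dropping \<open>x powr l\<close> from the lower kernel bound makes the lower bound for
  the double integral a product of two single integrals. The constant \<open>C\<close> makes
  \<theta> admissible and the integrals finite, but is absent from the conclusion; hence the
  estimate is uniform over truncations.\<close>

lemma moment_bound:
  fixes l k1 k2 C :: real and K :: "real \<Rightarrow> real \<Rightarrow> real" and S \<phi> \<theta> :: "real \<Rightarrow> real"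
  assumes K: "coagulation_kernel K"
    and "0 < k1"
    and K_bounds: "\<And>x y. 0 < x \<Longrightarrow> 0 < y \<Longrightarrow>
      k1 * (x powr l + y powr l) \<le> K x y \<and> K x y \<le> k2 * (x powr l + y powr l)"
    and stat: "stationary_solution l K S \<phi>"
    and cont: "continuous_on {0<..} \<theta>" and anti: "antimono_on {0<..} \<theta>"
    and \<theta>_bounds: "\<And>x. 0 < x \<Longrightarrow> 0 \<le> \<theta> x \<and> \<theta> x \<le> C"
  shows "k1 * (LINT y|lebesgue_pos. y powr l * \<phi> y) * (LINT x|lebesgue_pos. \<theta> x * \<phi> x)
    \<le> 2 * (LINT x|lebesgue_pos. S x * \<theta> x)"
proof -
  have \<phi>_meas: "\<phi> \<in> borel_measurable lebesgue_pos"
    and \<phi>_int: "integrable lebesgue_pos \<phi>"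
    and \<phi>_l_int: "integrable lebesgue_pos (\<lambda>y. y powr l * \<phi> y)"
    and \<phi>_nonneg: "AE x in lebesgue_pos. 0 \<le> \<phi> x"
    using stat unfolding stationary_solution_def pos_cone_def
    by (auto simp: X_space_0_iff) (auto simp: X_space_iff)
  have \<theta>_meas: "\<theta> \<in> borel_measurable lebesgue_pos"
    using cont by (intro continuous_imp_measurable_on_sets_lebesgue) auto
  \<comment> \<open>The sign makes \<open>F\<close> non-negative on the quadrant. The factor
    \<open>\<phi> x\<close> stays outside, so that \<open>I x\<close> has the form treated by
    \<open>kernel_integral_measurable\<close>.\<close>
  define F where "F x y = - chi \<theta> x y * K x y" for x y
  define I where "I x = (LINT y|lebesgue_pos. F x y * \<phi> y)" for x
  define M0 where "M0 = (LINT y|lebesgue_pos. \<phi> y)"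
  define Ml where "Ml = (LINT y|lebesgue_pos. y powr l * \<phi> y)"
  have quadrant: "{0::real<..} \<times> {0::real<..} \<in> sets lebesgue"
    by (intro sets_completionI_sets) (simp add: open_Times borel_open)
  have "continuous_on ({0<..} \<times> {0<..}) (\<lambda>z. - chi \<theta> (fst z) (snd z))"
    unfolding chi_def
    by (intro continuous_intros continuous_on_compose2[OF cont]) auto
  then have "(\<lambda>z. - chi \<theta> (fst z) (snd z)) \<in> borel_measurable (lebesgue_on ({0<..} \<times> {0<..}))"
    using quadrant by (rule continuous_imp_measurable_on_sets_lebesgue)
  then have F_meas: "(\<lambda>(x, y). F x y) \<in> borel_measurable (lebesgue_on ({0<..} \<times> {0<..}))"
    using K unfolding coagulation_kernel_def F_def case_prod_beta'
    by (intro borel_measurable_times) auto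
  \<comment> \<open>The lower bound produces the estimate; the upper one, with \<open>2 * C\<close>
    from \<open>\<theta> x + \<theta> y\<close>, supplies integrable majorants.\<close>
  have F_bounds: "k1 * \<theta> x * y powr l \<le> F x y \<and> F x y \<le> 2 * C * k2 * (x powr l + y powr l)"
    if "0 < x" "0 < y" for x y
  proof -
    have "\<theta> (x + y) \<le> \<theta> y"
      using monotone_onD[OF anti, of y "x + y"] that by simp
    then have chi: "\<theta> x \<le> - chi \<theta> x y" "- chi \<theta> x y \<le> 2 * C"
      using \<theta>_bounds[of x] \<theta>_bounds[of y] \<theta>_bounds[of "x + y"] that by (auto simp: chi_def)
    have K': "k1 * y powr l \<le> K x y" "K x y \<le> k2 * (x powr l + y powr l)" "0 \<le> k1 * y powr l"
      using K_bounds[OF that] \<open>0 < k1\<close> by (auto simp: distrib_left intro: order_trans[rotated])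
    have "\<theta> x * (k1 * y powr l) \<le> F x y"
      unfolding F_def using chi K' \<theta>_bounds[OF that(1)] by (intro mult_mono) auto
    moreover have "F x y \<le> 2 * C * (k2 * (x powr l + y powr l))"
      unfolding F_def using chi K' \<theta>_bounds[OF that(1)] by (intro mult_mono) auto
    ultimately show ?thesis by (simp add: mult_ac)
  qed
  have I_bounds: "AE x in lebesgue_pos. k1 * \<theta> x * Ml \<le> I x \<and> I x \<le> 2 * C * k2 * (x powr l * M0 + Ml)"
    using kernel_integral_measurable(1)[OF F_meas \<phi>_meas] AE_space
  proof eventually_elim
    case (elim x)
    then have x: "0 < x" by simp
    let ?lower = "\<lambda>y. k1 * \<theta> x * (y powr l * \<phi> y)"
    let ?upper = "\<lambda>y. 2 * C * k2 * (x powr l * \<phi> y + y powr l * \<phi> y)"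
    have lower: "AE y in lebesgue_pos. ?lower y \<le> F x y * \<phi> y"
      using \<phi>_nonneg AE_space
    proof eventually_elim
      case (elim y)
      then have "k1 * \<theta> x * y powr l * \<phi> y \<le> F x y * \<phi> y"
        using F_bounds[OF x] by (intro mult_right_mono) auto
      then show ?case by (simp add: mult_ac)
    qed
    have upper: "AE y in lebesgue_pos. F x y * \<phi> y \<le> ?upper y"
      using \<phi>_nonneg AE_space
    proof eventually_elim
      case (elim y)
      then have "F x y * \<phi> y \<le> 2 * C * k2 * (x powr l + y powr l) * \<phi> y"
        using F_bounds[OF x] by (intro mult_right_mono) auto
      then show ?case by (simp add: algebra_simps)
    qed
    \<comment> \<open>Non-negativity turns the two-sided bound into a bound on the norm, as
      domination requires.\<close>
    have lower_nonneg: "AE y in lebesgue_pos. 0 \<le> ?lower y"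
      using \<phi>_nonneg by eventually_elim (use \<open>0 < k1\<close> \<theta>_bounds[OF x] in auto)
    have int_lower: "integrable lebesgue_pos ?lower" and int_upper: "integrable lebesgue_pos ?upper"
      using \<phi>_int \<phi>_l_int by auto
    have int: "integrable lebesgue_pos (\<lambda>y. F x y * \<phi> y)"
    proof (rule Bochner_Integration.integrable_bound[OF int_upper elim(1)])
      show "AE y in lebesgue_pos. norm (F x y * \<phi> y) \<le> norm (?upper y)"
        using lower upper lower_nonneg by eventually_elim auto
    qed
    have "(LINT y|lebesgue_pos. ?lower y) \<le> I x"
      unfolding I_def by (rule integral_mono_AE[OF int_lower int lower])
    moreover have "I x \<le> (LINT y|lebesgue_pos. ?upper y)"
      unfolding I_def by (rule integral_mono_AE[OF int int_upper upper])
    ultimately show ?case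
      using \<phi>_int \<phi>_l_int by (simp add: M0_def Ml_def)
  qed
  have Ml_nonneg: "0 \<le> Ml"
    unfolding Ml_def using \<phi>_nonneg by (intro integral_nonneg_AE) auto
  have I_meas: "I \<in> borel_measurable lebesgue_pos"
    unfolding I_def by (rule kernel_integral_measurable(2)[OF F_meas \<phi>_meas])
  have int_\<theta>: "integrable lebesgue_pos (\<lambda>x. \<theta> x * \<phi> x)"
  proof (rule Bochner_Integration.integrable_bound)
    show "integrable lebesgue_pos (\<lambda>x. C * \<phi> x)"
      using \<phi>_int by simp
    show "AE x in lebesgue_pos. norm (\<theta> x * \<phi> x) \<le> norm (C * \<phi> x)"
      using AE_space
    proof eventually_elim
      case (elim x)
      then show ?case
        using \<theta>_bounds[of x] by (auto simp: abs_mult intro!: mult_right_mono)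
    qed
  qed (use \<theta>_meas \<phi>_meas in measurable)
  have int_I: "integrable lebesgue_pos (\<lambda>x. \<phi> x * I x)"
  proof (rule Bochner_Integration.integrable_bound)
    \<comment> \<open>This majorant is \<phi> times the upper bound of \<open>I\<close>; it is
      integrable because \<phi> lies in both \<open>X_space 0\<close> and
      \<open>X_space l\<close>.\<close>
    show "integrable lebesgue_pos (\<lambda>x. 2 * C * k2 * (M0 * (x powr l * \<phi> x) + Ml * \<phi> x))"
      using \<phi>_int \<phi>_l_int by auto
    show "AE x in lebesgue_pos.
        norm (\<phi> x * I x) \<le> norm (2 * C * k2 * (M0 * (x powr l * \<phi> x) + Ml * \<phi> x))"
      using I_bounds \<phi>_nonneg AE_space
    proof eventually_elim
      case (elim x)
      have "0 \<le> k1 * \<theta> x * Ml"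
        using elim(3) \<open>0 < k1\<close> \<theta>_bounds[of x] Ml_nonneg by auto
      then have "0 \<le> \<phi> x * I x"
        using elim by auto
      moreover have "\<phi> x * I x \<le> \<phi> x * (2 * C * k2 * (x powr l * M0 + Ml))"
        using elim by (intro mult_left_mono) auto
      ultimately show ?case
        by (simp add: algebra_simps)
    qed
  qed (use I_meas \<phi>_meas in measurable)
  \<comment> \<open>A constant factor leaves the Bochner integral even if the integrand is not
    integrable, so the identity holds at every \<open>x\<close> and can be used as a rewrite rule
    under the outer integral.\<close>
  have "(LINT y|lebesgue_pos. chi \<theta> x y * K x y * \<phi> x * \<phi> y) = - (\<phi> x * I x)" for x
  proof -
    have "(\<lambda>y. chi \<theta> x y * K x y * \<phi> x * \<phi> y) = (\<lambda>y. - \<phi> x * (F x y * \<phi> y))"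
      by (simp add: F_def fun_eq_iff mult_ac)
    then show ?thesis by (simp add: I_def)
  qed
  moreover have "\<theta> \<in> Linfty_pos"
    unfolding Linfty_pos_def using \<theta>_meas \<theta>_bounds
    by (auto intro!: exI[of _ C] AE_lebesgue_posI)
  then have "1 / 2 * (LINT x|lebesgue_pos. LINT y|lebesgue_pos. chi \<theta> x y * K x y * \<phi> x * \<phi> y)
      + (LINT x|lebesgue_pos. S x * \<theta> x) = 0"
    using stat unfolding stationary_solution_def by blast
  ultimately have balance: "(LINT x|lebesgue_pos. \<phi> x * I x) = 2 * (LINT x|lebesgue_pos. S x * \<theta> x)"
    by simp
  have "(LINT x|lebesgue_pos. k1 * Ml * (\<theta> x * \<phi> x)) \<le> (LINT x|lebesgue_pos. \<phi> x * I x)"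
  proof (rule integral_mono_AE[OF _ int_I])
    show "integrable lebesgue_pos (\<lambda>x. k1 * Ml * (\<theta> x * \<phi> x))"
      using int_\<theta> by simp
    show "AE x in lebesgue_pos. k1 * Ml * (\<theta> x * \<phi> x) \<le> \<phi> x * I x"
      using I_bounds \<phi>_nonneg
    proof eventually_elim
      case (elim x)
      then have "\<phi> x * (k1 * \<theta> x * Ml) \<le> \<phi> x * I x"
        by (intro mult_left_mono) auto
      then show ?case by (simp add: mult_ac)
    qed
  qed
  then show ?thesis
    by (simp add: balance Ml_def)
qed

section \<open>Truncation of the weight and passage to the limit\<close>

theorem proposition2p2:
  fixes l k1 k2 :: real
    and K :: "real \<Rightarrow> real \<Rightarrow> real"
    and S \<phi> :: "real \<Rightarrow> real"
  assumes "0 \<le> l"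
    and "coagulation_kernel K"
    and "0 < k1" and "k1 < k2"
    and "\<forall>x>0. \<forall>y>0. k1 * (x powr l + y powr l) \<le> K x y \<and>
           K x y \<le> k2 * (x powr l + y powr l)"
    and "S \<in> pos_cone (X_space 0)"
    and "stationary_solution l K S \<phi>"
  shows "(\<forall>w :: real \<Rightarrow> real.
            continuous_on {0<..} w \<longrightarrow> (\<forall>x>0. 0 \<le> w x) \<longrightarrow> antimono_on {0<..} w \<longrightarrow>
            S \<in> weighted_L1 w \<longrightarrow> \<phi> \<in> weighted_L1 w) \<and>
         (\<forall>m<0. S \<in> X_space m \<longrightarrow> \<phi> \<in> X_space m)"
proof -
  have \<phi>_meas: "\<phi> \<in> borel_measurable lebesgue_pos"
    and \<phi>_int: "integrable lebesgue_pos \<phi>"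
    and \<phi>_l_int: "integrable lebesgue_pos (\<lambda>y. y powr l * \<phi> y)"
    and \<phi>_nonneg: "AE x in lebesgue_pos. 0 \<le> \<phi> x"
    using assms(7) unfolding stationary_solution_def pos_cone_def
    by (auto simp: X_space_0_iff) (auto simp: X_space_iff)
  have S_int: "integrable lebesgue_pos S" and S_nonneg: "AE x in lebesgue_pos. 0 \<le> S x"
    using assms(6) by (auto simp: pos_cone_def X_space_0_iff)
  define Ml where "Ml = (LINT y|lebesgue_pos. y powr l * \<phi> y)"
  have Ml_nonneg: "0 \<le> Ml"
    unfolding Ml_def using \<phi>_nonneg by (intro integral_nonneg_AE) auto
  have main: "\<phi> \<in> weighted_L1 w"
    if cont: "continuous_on {0<..} w" and nonneg: "\<forall>x>0. 0 \<le> w x"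
      and anti: "antimono_on {0<..} w" and S: "S \<in> weighted_L1 w" for w
  proof -
    have w_meas: "w \<in> borel_measurable lebesgue_pos"
      using cont by (intro continuous_imp_measurable_on_sets_lebesgue) auto
    have S_w: "integrable lebesgue_pos (\<lambda>x. w x * S x)"
      using S by (simp add: weighted_L1_iff[OF cont nonneg])
    have "integrable lebesgue_pos (\<lambda>x. w x * \<phi> x)"
    proof (cases "Ml = 0")
      case True
      \<comment> \<open>A vanishing moment of a non-negative function forces \<phi> to be zero
        almost everywhere, as \<open>y powr l\<close> is positive for positive
        \<open>y\<close>.\<close>
      then have "AE y in lebesgue_pos. y powr l * \<phi> y = 0"
        unfolding Ml_def using \<phi>_nonneg
        by (subst (asm) integral_nonneg_eq_0_iff_AE[OF \<phi>_l_int]) auto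
      then have "AE y in lebesgue_pos. w y * \<phi> y = 0"
        using AE_space by eventually_elim auto
      then show ?thesis
        using w_meas \<phi>_meas by (subst integrable_cong_AE[where g = "\<lambda>_. 0"]) auto
    next
      case False
      then have c: "0 < k1 * Ml"
        using Ml_nonneg \<open>0 < k1\<close> by simp
      \<comment> \<open>The weight may blow up at 0; cutting it at height \<open>n\<close> gives a
        bounded test function and preserves continuity and monotonicity.\<close>
      define \<theta> where "\<theta> n x = min (w x) (real n)" for n x
      have \<theta>_cont: "continuous_on {0<..} (\<theta> n)" for n
        unfolding \<theta>_def by (intro continuous_intros cont)
      have \<theta>_meas: "\<theta> n \<in> borel_measurable lebesgue_pos" for n
        using \<theta>_cont by (intro continuous_imp_measurable_on_sets_lebesgue) auto
      have \<theta>_bounds: "0 \<le> \<theta> n x \<and> \<theta> n x \<le> real n" if "0 < x" for n x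
        using nonneg that by (auto simp: \<theta>_def)
      have \<theta>_anti: "antimono_on {0<..} (\<theta> n)" for n
        using anti by (auto simp: \<theta>_def monotone_on_def intro: min.coboundedI1)
      have \<theta>_int: "integrable lebesgue_pos (\<lambda>x. \<theta> n x * f x)"
        if "integrable lebesgue_pos f" for n f
      proof (rule Bochner_Integration.integrable_bound)
        show "integrable lebesgue_pos (\<lambda>x. real n * f x)"
          using that by simp
        show "AE x in lebesgue_pos. norm (\<theta> n x * f x) \<le> norm (real n * f x)"
          using \<theta>_bounds by (intro AE_lebesgue_posI) (auto simp: abs_mult intro!: mult_right_mono)
      qed (use \<theta>_meas that in measurable)
      \<comment> \<open>The height \<open>n\<close> enters \<open>moment_bound\<close> only as its
        constant \<open>C\<close>, so the right-hand side is independent of \<open>n\<close>.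
        Division by \<open>k1 * Ml\<close> is where the case distinction is used.\<close>
      have bound: "(LINT x|lebesgue_pos. \<theta> n x * \<phi> x)
          \<le> 2 * (LINT x|lebesgue_pos. w x * S x) / (k1 * Ml)" for n
      proof -
        have "k1 * Ml * (LINT x|lebesgue_pos. \<theta> n x * \<phi> x) \<le> 2 * (LINT x|lebesgue_pos. S x * \<theta> n x)"
          unfolding Ml_def using assms(5)
          by (intro moment_bound[OF assms(2,3) _ assms(7) \<theta>_cont \<theta>_anti \<theta>_bounds]) auto
        also have "(LINT x|lebesgue_pos. S x * \<theta> n x) \<le> (LINT x|lebesgue_pos. w x * S x)"
        proof (rule integral_mono_AE[OF _ S_w])
          show "integrable lebesgue_pos (\<lambda>x. S x * \<theta> n x)"
            using \<theta>_int[OF S_int] by (simp add: mult.commute)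
          show "AE x in lebesgue_pos. S x * \<theta> n x \<le> w x * S x"
            using S_nonneg
            by eventually_elim (auto simp: \<theta>_def mult.commute intro: mult_left_mono)
        qed
        finally show ?thesis
          using c by (simp add: field_simps)
      qed
      have mono: "AE x in lebesgue_pos. incseq (\<lambda>n. \<theta> n x * \<phi> x)"
        using \<phi>_nonneg
        by eventually_elim (auto simp: \<theta>_def incseq_def intro!: mult_right_mono)
      \<comment> \<open>At each fixed \<open>x\<close> the sequence is constant once
        \<open>n\<close> exceeds \<open>w x\<close>.\<close>
      have lim: "(\<lambda>n. \<theta> n x * \<phi> x) \<longlonglongrightarrow> w x * \<phi> x" for x
      proof (rule tendsto_eventually)
        obtain N where "w x \<le> real N"
          using real_arch_simple by blast
        then show "\<forall>\<^sub>F n in sequentially. \<theta> n x * \<phi> x = w x * \<phi> x"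
          by (intro eventually_sequentiallyI[of N]) (simp add: \<theta>_def)
      qed
      \<comment> \<open>Monotone convergence requires the integrals to converge; they do, being
        increasing and bounded above.\<close>
      have "incseq (\<lambda>n. LINT x|lebesgue_pos. \<theta> n x * \<phi> x)"
        unfolding incseq_def
      proof (intro allI impI integral_mono_AE \<theta>_int \<phi>_int)
        fix m n :: nat assume "m \<le> n"
        then show "AE x in lebesgue_pos. \<theta> m x * \<phi> x \<le> \<theta> n x * \<phi> x"
          using mono by (auto simp: incseq_def)
      qed
      then obtain L where "(\<lambda>n. LINT x|lebesgue_pos. \<theta> n x * \<phi> x) \<longlonglongrightarrow> L"
        using incseq_convergent[of "\<lambda>n. LINT x|lebesgue_pos. \<theta> n x * \<phi> x"] bound by metis
      then show ?thesis
        using w_meas \<phi>_meas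
        by (intro integrable_monotone_convergence[OF \<theta>_int[OF \<phi>_int] mono AE_I2[OF lim]]) auto
    qed
    then show ?thesis
      using \<phi>_meas by (simp add: weighted_L1_iff[OF cont nonneg])
  qed
  \<comment> \<open>For negative \<open>m\<close> the weight \<open>x powr m\<close> is itself
    continuous, non-negative and non-increasing on the positive half-line.\<close>
  moreover have "\<phi> \<in> X_space m" if "m < 0" "S \<in> X_space m" for m
    using that unfolding X_space_def
    by (intro main) (auto intro!: continuous_intros monotone_onI powr_mono2')
  ultimately show ?thesis by blast
qed

end
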